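(* Let $R$ be a commutative ring with unit element and let $R'$ be the subring of $R$ generated by $1$. If $s(R)<\infty$, then $R'$ is a finite ring and $|R'|$ divides $s(R)!$.
   Context: For a commutative ring $R$ with unit element, define $$s(R):=\min\{m\in\mathbb{N} : \exists\, p\in R[x] \text{ with } \deg(p)<m \text{ and } p(x)=x^m \text{ for all } x\in R\},$$ with $s(R):=\infty$ if no such $m$ exists. Here $\mathbb{N}=\{1,2,3,\dots\}$ and the zero polynomial is regarded as having degree smaller than every natural number. The ring $R$ may be infinite. *)

theory Defs
  imports "HOL-Algebra.UnivPoly" "HOL-Algebra.Generated_Rings" "HOL-Library.Extended_Nat"
begin

text \<open>
  Since \<^term>\<open>deg R\<close> assigns degree 0 to the zero polynomial, the convention that the zero
  polynomial has degree below every natural number is made explicit.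
\<close>

definition degree_less :: "('a, 'b) ring_scheme \<Rightarrow> (nat \<Rightarrow> 'a) \<Rightarrow> nat \<Rightarrow> bool" where
  "degree_less R p m \<longleftrightarrow> p = \<zero>\<^bsub>UP R\<^esub> \<or> deg R p < m"

text \<open>
  In \<^typ>\<open>enat\<close> the infimum of a nonempty set is its minimum and the infimum of the empty set
  is \<open>\<infinity>\<close>.
\<close>

definition s_ring :: "('a, 'b) ring_scheme \<Rightarrow> enat" where
  "s_ring R = Inf (enat ` {m. 1 \<le> m \<and>
     (\<exists>p \<in> carrier (UP R). degree_less R p m \<and>
        (\<forall>x \<in> carrier R. UnivPoly.eval R R id x p = x [^]\<^bsub>R\<^esub> m))})"

end

theory Submission
  imports Defs "HOL-Algebra.Multiplicative_Group"
begin

text \<open>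
  The additive order of \<open>1\<close> is the number of elements of the subring \<open>R'\<close> generated by \<open>1\<close>, since
  \<open>R'\<close> consists of the integer multiples of \<open>1\<close>. It therefore suffices to show \<open>m! \<cdot> 1 = 0\<close> for
  \<open>m = s(R)\<close>: then \<open>1\<close> has finite order, and this order divides \<open>m!\<close>.

  To see this, apply the \<open>m\<close>-th finite difference at \<open>0\<close>, the functional
  \<open>f \<mapsto> \<Sum>k\<le>m. (-1)^k * (m choose k) * f k\<close>, to the identity \<open>x^m = p(x)\<close> at the points
  \<open>x = k \<cdot> 1\<close> with \<open>k \<le> m\<close>. The functional kills the powers \<open>k^i\<close> with \<open>i < m\<close>, hence every
  polynomial of degree below \<open>m\<close>, whereas it sends \<open>k^m\<close> to \<open>(-1)^m * m!\<close>
  (\<open>alternating_binomial_power_sum\<close>). This gives \<open>m! \<cdot> 1 = 0\<close>.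
\<close>

text \<open>
  Absorption, \<open>k * (m+1 choose k) = (m+1) * (m choose k-1)\<close>, trades one factor of the power for a
  decrease of \<open>m\<close>; expanding \<open>(k+1)^j\<close> then expresses the sum for \<open>m + 1\<close> and \<open>j + 1\<close> through those
  for \<open>m\<close> and exponents up to \<open>j\<close>, of which at most the one with exponent \<open>m\<close> survives.
\<close>

lemma alternating_binomial_power_sum:
  fixes m j :: nat
  assumes "j \<le> m"
  shows "(\<Sum>k\<le>m. (-1) ^ k * int (m choose k) * int k ^ j) = (if j = m then (-1) ^ m * fact m else 0)"
  using assms
proof (induction m arbitrary: j)
  case 0
  then show ?case by simp
next
  case (Suc m)
  show ?case
  proof (cases j)
    case 0
    then show ?thesis
      using choose_alternating_sum[of "Suc m", where 'a = int] by simp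
  next
    case (Suc i)
    with Suc.prems have "i \<le> m" by simp
    have absorb: "int (Suc m choose Suc k) * int (Suc k) = int (Suc m) * int (m choose k)" for k
      by (metis Suc_times_binomial_eq of_nat_mult mult.commute)
    have "(\<Sum>k\<le>Suc m. (-1) ^ k * int (Suc m choose k) * int k ^ j)
        = (\<Sum>k\<le>m. (-1) ^ Suc k * int (Suc m choose Suc k) * int (Suc k) ^ Suc i)"
      by (subst sum.atMost_Suc_shift) (simp add: Suc)
    also have "\<dots> = (\<Sum>k\<le>m. - int (Suc m) * ((-1) ^ k * int (m choose k) * int (Suc k) ^ i))"
    proof (rule sum.cong[OF refl])
      fix k
      have "(-1) ^ Suc k * int (Suc m choose Suc k) * int (Suc k) ^ Suc i
          = - ((-1) ^ k) * (int (Suc m choose Suc k) * int (Suc k)) * int (Suc k) ^ i"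
        by (simp only: power_Suc mult_ac mult_minus_left mult_1_left)
      then show "(-1) ^ Suc k * int (Suc m choose Suc k) * int (Suc k) ^ Suc i
          = - int (Suc m) * ((-1) ^ k * int (m choose k) * int (Suc k) ^ i)"
        unfolding absorb by (simp only: mult_ac mult_minus_left mult_minus_right)
    qed
    also have "\<dots> = - int (Suc m) * (\<Sum>k\<le>m. (-1) ^ k * int (m choose k) * int (Suc k) ^ i)"
      by (simp only: sum_distrib_left)
    also have "(\<Sum>k\<le>m. (-1) ^ k * int (m choose k) * int (Suc k) ^ i)
        = (\<Sum>k\<le>m. \<Sum>l\<le>i. int (i choose l) * ((-1) ^ k * int (m choose k) * int k ^ l))"
    proof (rule sum.cong[OF refl])
      fix k
      have "int (Suc k) ^ i = (\<Sum>l\<le>i. int (i choose l) * int k ^ l)"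
        using binomial_ring[of "int k" 1 i] by (simp add: add.commute)
      then show "(-1) ^ k * int (m choose k) * int (Suc k) ^ i
          = (\<Sum>l\<le>i. int (i choose l) * ((-1) ^ k * int (m choose k) * int k ^ l))"
        by (simp only: sum_distrib_left mult_ac)
    qed
    also have "\<dots> = (\<Sum>l\<le>i. int (i choose l) * (\<Sum>k\<le>m. (-1) ^ k * int (m choose k) * int k ^ l))"
      by (subst sum.swap) (simp only: sum_distrib_left)
    also have "\<dots> = (\<Sum>l\<le>i. if l = m then int (i choose l) * ((-1) ^ m * fact m) else 0)"
      using \<open>i \<le> m\<close> by (intro sum.cong) (auto simp: Suc.IH)
    also have "\<dots> = (if i = m then (-1) ^ m * fact m else 0)"
      using \<open>i \<le> m\<close> by (auto simp: sum.delta)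
    also have "- int (Suc m) * \<dots> = (if j = Suc m then (-1) ^ Suc m * fact (Suc m) else 0)"
      by (simp add: Suc algebra_simps)
    finally show ?thesis .
  qed
qed

lemma (in abelian_monoid) finsum_swap:
  assumes "finite A" "finite B" "\<And>i j. \<lbrakk>i \<in> A; j \<in> B\<rbrakk> \<Longrightarrow> f i j \<in> carrier G"
  shows "(\<Oplus>i\<in>A. \<Oplus>j\<in>B. f i j) = (\<Oplus>j\<in>B. \<Oplus>i\<in>A. f i j)"
  using assms(1,3)
proof (induction A rule: finite_induct)
  case empty
  then show ?case by (simp add: finsum_zero)
next
  case (insert a A)
  have "(\<Oplus>i\<in>insert a A. \<Oplus>j\<in>B. f i j) = (\<Oplus>j\<in>B. f a j) \<oplus> (\<Oplus>j\<in>B. \<Oplus>i\<in>A. f i j)"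
    using insert by (subst finsum_insert) (auto intro!: finsum_closed)
  also have "\<dots> = (\<Oplus>j\<in>B. f a j \<oplus> (\<Oplus>i\<in>A. f i j))"
    using insert.prems by (subst finsum_addf) (auto intro!: finsum_closed)
  also have "\<dots> = (\<Oplus>j\<in>B. \<Oplus>i\<in>insert a A. f i j)"
    using insert by (intro finsum_cong') (auto simp: finsum_insert intro!: finsum_closed)
  finally show ?case .
qed

lemma (in abelian_group) finsum_add_pow_left:
  fixes g :: "'i \<Rightarrow> int"
  assumes "finite A" "a \<in> carrier G"
  shows "(\<Oplus>i\<in>A. [g i] \<cdot> a) = [(\<Sum>i\<in>A. g i)] \<cdot> a"
  using assms(1)
proof (induction A rule: finite_induct)
  case empty
  then show ?case using assms(2) by (simp add: add_pow_int_ge)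
next
  case (insert x A)
  then show ?case using assms(2) by (simp add: finsum_insert add.int_pow_mult)
qed

lemma (in abelian_group) finsum_add_pow_right:
  fixes c :: int
  assumes "finite A" "f \<in> A \<rightarrow> carrier G"
  shows "[c] \<cdot> (\<Oplus>i\<in>A. f i) = (\<Oplus>i\<in>A. [c] \<cdot> f i)"
  using assms
proof (induction A rule: finite_induct)
  case empty
  then show ?case by simp
next
  case (insert x A)
  then show ?case by (simp add: finsum_insert add.int_pow_distrib Pi_def)
qed

lemma (in ring) add_pow_one_mult:
  fixes k l :: int
  shows "[k] \<cdot> \<one> \<otimes> [l] \<cdot> \<one> = [(k * l)] \<cdot> \<one>"
  by (simp add: add_pow_ldistr_int add.int_pow_pow mult.commute)

lemma (in ring) add_pow_one_power:
  fixes k :: int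
  shows "([k] \<cdot> \<one>) [^] (i::nat) = [(k ^ i)] \<cdot> \<one>"
  by (induction i) (simp_all add: add_pow_one_mult mult.commute)

text \<open>
  The integer multiples of \<open>1\<close> are already closed under multiplication, so for the single generator
  \<open>1\<close> the ring closure adds nothing to the additive closure. This reduces the size of the generated
  ring to an element order in the additive group.
\<close>

lemma (in ring) generate_ring_one:
  "generate_ring R {\<one>} = generate (add_monoid R) {\<one>}"
proof
  have gen: "generate (add_monoid R) {\<one>} = {[k] \<cdot> \<one> | k :: int. True}"
    using add.generate_pow[OF one_closed] by simp
  show "generate_ring R {\<one>} \<subseteq> generate (add_monoid R) {\<one>}"
  proof
    fix x assume "x \<in> generate_ring R {\<one>}"
    then show "x \<in> generate (add_monoid R) {\<one>}"
    proof induction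
      case one
      show ?case by (rule generate.incl) simp
    next
      case (incl h)
      then show ?case by (rule generate.incl)
    next
      case (a_inv h)
      then show ?case unfolding gen
        using add.int_pow_neg[OF one_closed] by (auto, metis)
    next
      case (eng_add h1 h2)
      then show ?case using generate.eng[of h1 "add_monoid R"] by simp
    next
      case (eng_mult h1 h2)
      then show ?case unfolding gen by (auto simp: add_pow_one_mult)
    qed
  qed
  show "generate (add_monoid R) {\<one>} \<subseteq> generate_ring R {\<one>}"
  proof
    fix x assume "x \<in> generate (add_monoid R) {\<one>}"
    then show "x \<in> generate_ring R {\<one>}"
      by induction (auto simp: a_inv_def[symmetric] zero_in_generate intro: generate_ring.intros)
  qed
qed

lemma (in ring) generate_ring_one_order:
  fixes n :: nat
  assumes "n > 0" "[n] \<cdot> \<one> = \<zero>"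
  shows "finite (generate_ring R {\<one>})" "card (generate_ring R {\<one>}) dvd n"
proof -
  have "card (generate_ring R {\<one>}) = add.ord \<one>"
    by (simp add: generate_ring_one add.generate_pow_card)
  moreover from assms(2) have "add.ord \<one> dvd n"
    using add.pow_eq_id[OF one_closed] by simp
  ultimately show dvd: "card (generate_ring R {\<one>}) dvd n" by simp
  \<comment> \<open>An infinite set has cardinality \<open>0\<close>, which divides no positive number.\<close>
  show "finite (generate_ring R {\<one>})"
  proof (rule ccontr)
    assume "infinite (generate_ring R {\<one>})"
    with dvd assms(1) show False by simp
  qed
qed

text \<open>
  An integer combination of the values of a polynomial at multiples of \<open>1\<close> depends only on the integer
  combinations of the powers \<open>k^i\<close>. This transfers vanishing identities over the integers to
  arbitrary coefficients from the ring.
\<close>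

lemma (in ring) weighted_polynomial_values:
  fixes c :: "nat \<Rightarrow> int" and n m :: nat
  assumes a: "\<And>i. a i \<in> carrier R"
  shows "(\<Oplus>k\<in>{..m}. [c k] \<cdot> (\<Oplus>i\<in>{..n}. a i \<otimes> ([int k] \<cdot> \<one>) [^] i))
       = (\<Oplus>i\<in>{..n}. [(\<Sum>k\<le>m. c k * int k ^ i)] \<cdot> a i)"
proof -
  have "[c k] \<cdot> (\<Oplus>i\<in>{..n}. a i \<otimes> ([int k] \<cdot> \<one>) [^] i)
      = (\<Oplus>i\<in>{..n}. [(c k * int k ^ i)] \<cdot> a i)" for k
  proof -
    have "[c k] \<cdot> (a i \<otimes> ([int k] \<cdot> \<one>) [^] i) = [(c k * int k ^ i)] \<cdot> a i" for i
      using a[of i]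
      by (simp add: add_pow_one_power add_pow_rdistr_int add.int_pow_pow mult.commute)
    then show ?thesis
      using a by (simp add: finsum_add_pow_right Pi_def)
  qed
  then have "(\<Oplus>k\<in>{..m}. [c k] \<cdot> (\<Oplus>i\<in>{..n}. a i \<otimes> ([int k] \<cdot> \<one>) [^] i))
      = (\<Oplus>k\<in>{..m}. \<Oplus>i\<in>{..n}. [(c k * int k ^ i)] \<cdot> a i)"
    by simp
  also have "\<dots> = (\<Oplus>i\<in>{..n}. \<Oplus>k\<in>{..m}. [(c k * int k ^ i)] \<cdot> a i)"
    using a by (intro finsum_swap) auto
  also have "\<dots> = (\<Oplus>i\<in>{..n}. [(\<Sum>k\<le>m. c k * int k ^ i)] \<cdot> a i)"
    using a by (simp add: finsum_add_pow_left)
  finally show ?thesis .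
qed

text \<open>
  Weighted with \<open>(-1)^k * (m choose k)\<close>, the values of the left-hand polynomial at the points
  \<open>k \<cdot> 1\<close> sum to zero and those of \<open>x^m\<close> to \<open>(-1)^m * m! \<cdot> 1\<close>. The sign is removed by passing to
  divisibility by the additive order of \<open>1\<close>.
\<close>

lemma (in ring) fact_multiple_of_one_eq_zero:
  fixes n m :: nat
  assumes a: "\<And>i. a i \<in> carrier R" and "n < m"
    and power: "\<And>x. x \<in> carrier R \<Longrightarrow> (\<Oplus>i\<in>{..n}. a i \<otimes> x [^] i) = x [^] m"
  shows "[(fact m :: nat)] \<cdot> \<one> = \<zero>"
proof -
  define c where "c k = (-1) ^ k * int (m choose k)" for k
  have value_at: "(\<Oplus>i\<in>{..n}. a i \<otimes> ([int k] \<cdot> \<one>) [^] i) = [(int k ^ m)] \<cdot> \<one>" for k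
    using power[of "[int k] \<cdot> \<one>"] by (simp add: add_pow_one_power)
  have "\<zero> = (\<Oplus>i\<in>{..n}. [(\<Sum>k\<le>m. c k * int k ^ i)] \<cdot> a i)"
  proof -
    have "[(\<Sum>k\<le>m. c k * int k ^ i)] \<cdot> a i = \<zero>" if "i \<le> n" for i
      using that \<open>n < m\<close> a by (simp add: c_def alternating_binomial_power_sum add_pow_int_ge)
    then show ?thesis
      by (intro add.finprod_one_eqI[symmetric]) simp
  qed
  also have "\<dots> = (\<Oplus>k\<in>{..m}. [c k] \<cdot> ([(int k ^ m)] \<cdot> \<one>))"
    unfolding weighted_polynomial_values[OF a, symmetric] value_at ..
  also have "\<dots> = (\<Oplus>k\<in>{..m}. [(c k * int k ^ m)] \<cdot> \<one>)"
    by (simp add: add.int_pow_pow mult.commute)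
  also have "\<dots> = [(\<Sum>k\<le>m. c k * int k ^ m)] \<cdot> \<one>"
    by (simp add: finsum_add_pow_left)
  also have "\<dots> = [((-1) ^ m * fact m :: int)] \<cdot> \<one>"
    by (simp add: c_def alternating_binomial_power_sum)
  finally have "int (add.ord \<one>) dvd (-1) ^ m * fact m"
    using add.int_pow_eq_id[OF one_closed] by metis
  then have "int (add.ord \<one>) dvd int (fact m)"
    by (cases "even m") simp_all
  then have "add.ord \<one> dvd fact m"
    by (simp only: of_nat_dvd_iff)
  then show ?thesis
    using add.pow_eq_id[OF one_closed] by simp
qed

lemma s_ring_attained:
  assumes "ring R" "s_ring R < \<infinity>"
  obtains p where "p \<in> carrier (UP R)" "deg R p < the_enat (s_ring R)"
    "\<And>x. x \<in> carrier R \<Longrightarrow> UnivPoly.eval R R id x p = x [^]\<^bsub>R\<^esub> the_enat (s_ring R)"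
proof -
  define M where "M = {m. 1 \<le> m \<and>
     (\<exists>p \<in> carrier (UP R). degree_less R p m \<and>
        (\<forall>x \<in> carrier R. UnivPoly.eval R R id x p = x [^]\<^bsub>R\<^esub> m))}"
  have s: "s_ring R = Inf (enat ` M)"
    unfolding s_ring_def M_def ..
  with assms(2) have "M \<noteq> {}"
    by (auto simp: Inf_enat_def)
  then have "s_ring R \<in> enat ` M"
    unfolding s Inf_enat_def by (auto intro: LeastI)
  then have "the_enat (s_ring R) \<in> M"
    by auto
  then obtain p where "1 \<le> the_enat (s_ring R)" and p: "p \<in> carrier (UP R)"
      "degree_less R p (the_enat (s_ring R))"
      "\<And>x. x \<in> carrier R \<Longrightarrow> UnivPoly.eval R R id x p = x [^]\<^bsub>R\<^esub> the_enat (s_ring R)"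
    by (auto simp: M_def)
  \<comment> \<open>For \<open>p = 0\<close> the degree is \<open>0\<close> by convention, which is still below the exponent since that is positive.\<close>
  have "deg R p < the_enat (s_ring R)"
    using p(2) \<open>1 \<le> _\<close> UP_ring.deg_zero[OF UP_ring.intro[OF assms(1)]]
    by (auto simp: degree_less_def)
  with p that show ?thesis by blast
qed

theorem proposition5:
  fixes R :: "('a, 'b) ring_scheme"
  assumes "cring R"
    and "s_ring R < \<infinity>"
  shows "finite (generate_ring R {\<one>\<^bsub>R\<^esub>}) \<and>
         card (generate_ring R {\<one>\<^bsub>R\<^esub>}) dvd fact (the_enat (s_ring R))"
proof -
  interpret UP_cring R "UP R"
    by (rule UP_cring.intro) (rule assms(1))
  obtain p where p: "p \<in> carrier (UP R)" "deg R p < the_enat (s_ring R)"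
    and eval: "\<And>x. x \<in> carrier R \<Longrightarrow> UnivPoly.eval R R id x p = x [^]\<^bsub>R\<^esub> the_enat (s_ring R)"
    using s_ring_attained[OF R.ring_axioms assms(2)] by metis
  have "[(fact (the_enat (s_ring R)) :: nat)] \<cdot>\<^bsub>R\<^esub> \<one>\<^bsub>R\<^esub> = \<zero>\<^bsub>R\<^esub>"
    using p eval
    by (intro R.fact_multiple_of_one_eq_zero[where a = "coeff (UP R) p" and n = "deg R p"])
       (simp_all add: eval_on_carrier)
  then show ?thesis
    using R.generate_ring_one_order[of "fact (the_enat (s_ring R))"] by simp
qed

end
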